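(* Let $f$ be an arc-symmetric function, let $T$ be a traffic matrix, and let $T^*=(T+T^{\top})/2$ be its symmetric counterpart. Then $$\min_{(x,y)\in U(T)} f(x,y)=\min_{(x,y)\in B(2T^* )} g(x,y),$$ where $g(x,y)=f(\tfrac12 x,y)$. Furthermore, optimal solutions to each of the two problems can be mapped into optimal solutions to the other (in particular, if one problem has an optimal solution, so does the other).
   Context: $G=(N,E)$ is a finite undirected graph with edges $\{i,j\}$, $i\neq j$; $A$ is the arc set containing both arcs $(ij)$ and $(ji)$ for each edge $\{i,j\}\in E$. $M$ is a finite set of facility types; a unit of facility $m\in M$ provides capacity $c_m\in\mathbb{Z}$, with $c_1<c_2<\dots<c_{|M|}$. $\bar c\in\mathbb{R}^E$ is the vector of existing edge capacities. $K=\{(ij)\in N\times N : i\neq j\}$ is the set of commodities. A traffic matrix is a matrix $T=\{t_{ij}\}_{i,j\in N}$ with $t_{ij}\ge 0$. For $k=(ij)\in K$ and $u\in N$, let $d_u^k=t_{ij}$ if $u=j$, $d_u^k=-t_{ij}$ if $u=i$, and $d_u^k=0$ otherwise. Flow variables are $x=(x_{ij}^k)\in\mathbb{R}^{A\times K}$, and capacity variables are $y=(y_{m,e})\in\mathbb{R}^{M\times E}$. The flow balance constraints for $T$ are $$\sum_{j:(ij)\in A} x_{ij}^k-\sum_{j:(ji)\in A}x_{ji}^k=d_i^k\quad\text{for all } k\in K,\ i\in N.$$ $U(T)$ (undirected capacity model) is the set of $(x,y)$ with $x\ge 0$, $y\ge 0$, $y\in\mathbb{Z}^{M\times E}$ satisfying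 the flow balance constraints for $T$ and $$\sum_{k\in K}x_{ij}^k+\sum_{k\in K}x_{ji}^k\le \bar c_e+\sum_{m\in M}c_m y_{m,e}\quad\text{for all } e=\{i,j\}\in E.$$ $B(T)$ (bidirected capacity model) is the set of $(x,y)$ with $x\ge 0$, $y\ge 0$, $y\in\mathbb{Z}^{M\times E}$ satisfying the flow balance constraints for $T$ and $$\max\Big\{\sum_{k\in K}x_{ij}^k,\ \sum_{k\in K}x_{ji}^k\Big\}\le \bar c_e+\sum_{m\in M}c_m y_{m,e}\quad\text{for all } e=\{i,j\}\in E.$$ The same $G$, $M$, $c$ and $\bar c$ are used in both models; $B(2T^* )$ is the set for the traffic matrix $2T^*=T+T^{\top}$. A real-valued function $f$ of $(x,y)$ is arc-symmetric if $f(x,y)=f(\hat x,y)$ whenever $x_{ij}^{vu}+x_{ji}^{vu}+x_{ij}^{uv}+x_{ji}^{uv}=\hat x_{ij}^{vu}+\hat x_{ji}^{vu}+\hat x_{ij}^{uv}+\hat x_{ji}^{uv}$ for all $uv,vu\in K$ and all $\{i,j\}\in E$. Here $\min$ denotes the optimal value of the problem (the infimum in the extended reals, $+\infty$ if infeasible). *)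

theory Defs
  imports "HOL-Library.FuncSet" "HOL-Library.Extended_Real"
begin

text \<open>
  The facility types are \<open>{1..ntypes G}\<close>. An edge \<open>e\<close> is the two-element set of its endpoints.
\<close>

record 'v network =
  nodes :: "'v set"
  edges :: "'v set set"
  ntypes :: nat
  cap :: "nat \<Rightarrow> int"
  excap :: "'v set \<Rightarrow> real"

definition network :: "'v network \<Rightarrow> bool" where
  "network G \<longleftrightarrow> finite (nodes G) \<and>
     edges G \<subseteq> {{i, j} | i j. i \<in> nodes G \<and> j \<in> nodes G \<and> i \<noteq> j} \<and>
     strict_mono_on {1..ntypes G} (cap G)"

definition arcs :: "'v network \<Rightarrow> ('v \<times> 'v) set" where
  "arcs G = {(i, j). {i, j} \<in> edges G}"

definition commodities :: "'v network \<Rightarrow> ('v \<times> 'v) set" where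
  "commodities G = {(i, j). i \<in> nodes G \<and> j \<in> nodes G \<and> i \<noteq> j}"

text \<open>
  A vector indexed by a set is a function that is \<^const>\<open>extensional\<close> on it, so that
  elements of the two spaces below correspond exactly to real vectors.
  The entry written \<open>x\<^sub>i\<^sub>j\<^sup>k\<close> on paper is \<open>x ((i, j), k)\<close>.
\<close>

type_synonym 'v flow = "('v \<times> 'v) \<times> ('v \<times> 'v) \<Rightarrow> real"
type_synonym 'v capacity = "nat \<times> 'v set \<Rightarrow> real"
type_synonym 'v traffic = "'v \<Rightarrow> 'v \<Rightarrow> real"

definition flow_space :: "'v network \<Rightarrow> 'v flow set" where
  "flow_space G = extensional (arcs G \<times> commodities G)"

definition capacity_space :: "'v network \<Rightarrow> 'v capacity set" where
  "capacity_space G = extensional ({1..ntypes G} \<times> edges G)"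

definition scale_flow :: "'v network \<Rightarrow> real \<Rightarrow> 'v flow \<Rightarrow> 'v flow" where
  "scale_flow G a x = (\<lambda>p \<in> arcs G \<times> commodities G. a * x p)"

definition traffic_matrix :: "'v network \<Rightarrow> 'v traffic \<Rightarrow> bool" where
  "traffic_matrix G T \<longleftrightarrow> (\<forall>i \<in> nodes G. \<forall>j \<in> nodes G. T i j \<ge> 0)"

definition symmetric_counterpart :: "'v traffic \<Rightarrow> 'v traffic" where
  "symmetric_counterpart T = (\<lambda>i j. (T i j + T j i) / 2)"

text \<open>
  Sign convention: the net outflow of commodity \<open>(i, j)\<close> is \<open>+ T i j\<close> at \<open>j\<close>
  and \<open>- T i j\<close> at \<open>i\<close>.
\<close>

definition demand :: "'v traffic \<Rightarrow> 'v \<times> 'v \<Rightarrow> 'v \<Rightarrow> real" where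
  "demand T k u =
     (if u = snd k then T (fst k) (snd k)
      else if u = fst k then - T (fst k) (snd k)
      else 0)"

definition flow_balance :: "'v network \<Rightarrow> 'v traffic \<Rightarrow> 'v flow \<Rightarrow> bool" where
  "flow_balance G T x \<longleftrightarrow>
     (\<forall>k \<in> commodities G. \<forall>i \<in> nodes G.
        (\<Sum>j | (i, j) \<in> arcs G. x ((i, j), k)) - (\<Sum>j | (j, i) \<in> arcs G. x ((j, i), k))
          = demand T k i)"

definition arc_load :: "'v network \<Rightarrow> 'v flow \<Rightarrow> 'v \<times> 'v \<Rightarrow> real" where
  "arc_load G x a = (\<Sum>k \<in> commodities G. x (a, k))"

definition edge_capacity :: "'v network \<Rightarrow> 'v capacity \<Rightarrow> 'v set \<Rightarrow> real" where
  "edge_capacity G y e = excap G e + (\<Sum>m = 1..ntypes G. of_int (cap G m) * y (m, e))"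

definition common_constraints ::
    "'v network \<Rightarrow> 'v traffic \<Rightarrow> 'v flow \<Rightarrow> 'v capacity \<Rightarrow> bool" where
  "common_constraints G T x y \<longleftrightarrow>
     x \<in> flow_space G \<and> y \<in> capacity_space G \<and>
     (\<forall>p \<in> arcs G \<times> commodities G. x p \<ge> 0) \<and>
     (\<forall>p \<in> {1..ntypes G} \<times> edges G. y p \<ge> 0 \<and> y p \<in> \<int>) \<and>
     flow_balance G T x"

definition undirected_model :: "'v network \<Rightarrow> 'v traffic \<Rightarrow> ('v flow \<times> 'v capacity) set" where
  "undirected_model G T = {(x, y). common_constraints G T x y \<and>
     (\<forall>i j. {i, j} \<in> edges G \<longrightarrow>
        arc_load G x (i, j) + arc_load G x (j, i) \<le> edge_capacity G y {i, j})}"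

definition bidirected_model :: "'v network \<Rightarrow> 'v traffic \<Rightarrow> ('v flow \<times> 'v capacity) set" where
  "bidirected_model G T = {(x, y). common_constraints G T x y \<and>
     (\<forall>i j. {i, j} \<in> edges G \<longrightarrow>
        max (arc_load G x (i, j)) (arc_load G x (j, i)) \<le> edge_capacity G y {i, j})}"

definition arc_symmetric :: "'v network \<Rightarrow> ('v flow \<times> 'v capacity \<Rightarrow> real) \<Rightarrow> bool" where
  "arc_symmetric G f \<longleftrightarrow>
     (\<forall>x \<in> flow_space G. \<forall>x' \<in> flow_space G. \<forall>y \<in> capacity_space G.
        (\<forall>u v i j. (u, v) \<in> commodities G \<and> {i, j} \<in> edges G \<longrightarrow>
           x ((i, j), (v, u)) + x ((j, i), (v, u)) + x ((i, j), (u, v)) + x ((j, i), (u, v))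
           = x' ((i, j), (v, u)) + x' ((j, i), (v, u)) + x' ((i, j), (u, v)) + x' ((j, i), (u, v)))
        \<longrightarrow> f (x, y) = f (x', y))"

text \<open>The infimum in the extended reals; it is \<open>\<infinity>\<close> if \<open>S\<close> is empty.\<close>

definition opt_value :: "('a \<Rightarrow> real) \<Rightarrow> 'a set \<Rightarrow> ereal" where
  "opt_value f S = (INF z \<in> S. ereal (f z))"

definition opt_solutions :: "('a \<Rightarrow> real) \<Rightarrow> 'a set \<Rightarrow> 'a set" where
  "opt_solutions f S = {z. is_arg_min f (\<lambda>w. w \<in> S) z}"

end

theory Submission
  imports Defs
begin

text \<open>
  Reversing a flow of commodity \<open>vu\<close> turns it into a flow of commodity \<open>uv\<close>. Hence, with
  \<open>s = x\<^sup>u\<^sup>v + reverse (x\<^sup>v\<^sup>u)\<close>, a flow \<open>x\<close> for \<open>T\<close> yields a flow \<open>s\<close> for \<open>T + T\<^sup>T\<close> whose load on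
  either direction of an edge is the undirected load of \<open>x\<close>. Conversely, from a flow \<open>x\<close> for
  \<open>T + T\<^sup>T\<close>, half of \<open>s\<close> is again a flow for \<open>T + T\<^sup>T\<close>, and it is split between \<open>uv\<close> and \<open>vu\<close> in
  the proportion of \<open>T u v\<close> to \<open>T v u\<close>; the undirected load of the result is the mean of the two
  directed loads of \<open>x\<close>, which is at most their maximum. Both maps only scale the four-term sums
  on which an arc-symmetric function depends, so they preserve the objective values.
\<close>

text \<open>The weight \<alpha> depends on the ordered pair, so one construction serves both
  directions of the proof: constant weight 1 merges, and \<open>share T\<close> splits unevenly
  between \<open>uv\<close> and \<open>vu\<close>.\<close>

definition merge_flow :: "'v network \<Rightarrow> ('v \<Rightarrow> 'v \<Rightarrow> real) \<Rightarrow> 'v flow \<Rightarrow> 'v flow" where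
  "merge_flow G \<alpha> x = (\<lambda>((i, j), (u, v)) \<in> arcs G \<times> commodities G.
     \<alpha> u v * (x ((i, j), (u, v)) + x ((j, i), (v, u))))"

definition pair_flow :: "'v flow \<Rightarrow> 'v \<Rightarrow> 'v \<Rightarrow> 'v \<Rightarrow> 'v \<Rightarrow> real" where
  "pair_flow x i j u v =
     x ((i, j), (v, u)) + x ((j, i), (v, u)) + x ((i, j), (u, v)) + x ((j, i), (u, v))"

lemma arcs_commute: "(j, i) \<in> arcs G \<longleftrightarrow> (i, j) \<in> arcs G"
  by (simp add: arcs_def insert_commute)

lemma commodities_commute: "(v, u) \<in> commodities G \<longleftrightarrow> (u, v) \<in> commodities G"
  by (auto simp: commodities_def)

lemma sum_commodities_swap:
  "(\<Sum>k \<in> commodities G. h (prod.swap k)) = (\<Sum>k \<in> commodities G. h k)"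
proof (rule sum.reindex_bij_betw)
  show "bij_betw prod.swap (commodities G) (commodities G)"
    by (rule bij_betwI[of _ _ _ prod.swap]) (auto simp: commodities_commute)
qed

lemma merge_flow_apply:
  assumes "(i, j) \<in> arcs G" "(u, v) \<in> commodities G"
  shows "merge_flow G \<alpha> x ((i, j), (u, v)) = \<alpha> u v * (x ((i, j), (u, v)) + x ((j, i), (v, u)))"
  using assms by (simp add: merge_flow_def)

lemma merge_flow_in_flow_space: "merge_flow G \<alpha> x \<in> flow_space G"
  by (simp add: merge_flow_def flow_space_def)

lemma scale_flow_in_flow_space: "scale_flow G a x \<in> flow_space G"
  by (simp add: scale_flow_def flow_space_def)

lemma pair_flow_scale_flow:
  assumes "(i, j) \<in> arcs G" "(u, v) \<in> commodities G"
  shows "pair_flow (scale_flow G a x) i j u v = a * pair_flow x i j u v"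
  using assms by (simp add: pair_flow_def scale_flow_def arcs_commute commodities_commute algebra_simps)

text \<open>The two merged entries of commodity \<open>uv\<close> on an edge already collect all
  four terms of \<open>pair_flow x\<close>, weighted by \<open>\<alpha> u v\<close>; those of
  \<open>vu\<close> collect the same four terms, weighted by \<open>\<alpha> v u\<close>.\<close>

lemma pair_flow_merge_flow:
  assumes "(i, j) \<in> arcs G" "(u, v) \<in> commodities G"
  shows "pair_flow (merge_flow G \<alpha> x) i j u v = (\<alpha> u v + \<alpha> v u) * pair_flow x i j u v"
  using assms
  by (simp add: pair_flow_def merge_flow_apply arcs_commute commodities_commute algebra_simps)

lemma arc_symmetricD:
  assumes "arc_symmetric G f" "x \<in> flow_space G" "x' \<in> flow_space G" "y \<in> capacity_space G"
    and "\<And>i j u v. (i, j) \<in> arcs G \<Longrightarrow> (u, v) \<in> commodities G \<Longrightarrow>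
           pair_flow x i j u v = pair_flow x' i j u v"
  shows "f (x, y) = f (x', y)"
  using assms(1)[unfolded arc_symmetric_def, rule_format, OF assms(2-4)] assms(5)
  unfolding pair_flow_def arcs_def by blast

text \<open>The factor 2 arises because the sum runs over ordered pairs and so meets each unordered
  pair twice.\<close>

lemma edge_load_eq_pair_flow:
  "2 * (arc_load G x (i, j) + arc_load G x (j, i))
     = (\<Sum>(u, v) \<in> commodities G. pair_flow x i j u v)"
proof -
  have swap: "(\<Sum>(u, v) \<in> commodities G. x (a, (v, u))) = arc_load G x a" for a
    using sum_commodities_swap[of "\<lambda>k. x (a, k)" G]
    by (simp add: arc_load_def prod.swap_def case_prod_unfold)
  have "(\<Sum>(u, v) \<in> commodities G. pair_flow x i j u v)
      = (\<Sum>(u, v) \<in> commodities G. x ((i, j), (v, u))) + (\<Sum>(u, v) \<in> commodities G. x ((j, i), (v, u)))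
        + arc_load G x (i, j) + arc_load G x (j, i)"
    by (simp add: pair_flow_def arc_load_def case_prod_unfold sum.distrib)
  then show ?thesis
    by (simp add: swap)
qed

lemma edge_load_merge_flow:
  assumes "(i, j) \<in> arcs G"
    and "\<And>u v. (u, v) \<in> commodities G \<Longrightarrow> \<alpha> u v + \<alpha> v u = c"
  shows "arc_load G (merge_flow G \<alpha> x) (i, j) + arc_load G (merge_flow G \<alpha> x) (j, i)
     = c * (arc_load G x (i, j) + arc_load G x (j, i))"
proof -
  have "(\<Sum>(u, v) \<in> commodities G. pair_flow (merge_flow G \<alpha> x) i j u v)
      = (\<Sum>(u, v) \<in> commodities G. c * pair_flow x i j u v)"
    by (rule sum.cong) (auto simp: pair_flow_merge_flow assms)
  also have "\<dots> = c * (\<Sum>(u, v) \<in> commodities G. pair_flow x i j u v)"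
    by (simp add: sum_distrib_left case_prod_unfold)
  finally show ?thesis
    by (simp add: algebra_simps flip: edge_load_eq_pair_flow)
qed

text \<open>The bidirected constraint bounds each direction separately, so the total load of an edge
  is not enough here. Swapping \<open>uv\<close> and \<open>vu\<close> in the reversed terms turns
  their sum into the load of \<open>(j, i)\<close>.\<close>

lemma arc_load_merge_flow:
  assumes "(i, j) \<in> arcs G"
  shows "arc_load G (merge_flow G (\<lambda>u v. 1) x) (i, j) = arc_load G x (i, j) + arc_load G x (j, i)"
proof -
  have "arc_load G (merge_flow G (\<lambda>u v. 1) x) (i, j)
      = (\<Sum>k \<in> commodities G. x ((i, j), k) + x ((j, i), prod.swap k))"
    unfolding arc_load_def by (rule sum.cong) (auto simp: merge_flow_apply assms)
  then show ?thesis
    by (simp add: arc_load_def sum.distrib sum_commodities_swap[of "\<lambda>k. x ((j, i), k)"])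
qed

text \<open>Reversing a flow negates its net outflow, hence the minus sign on the demand of
  \<open>vu\<close>.\<close>

lemma demand_minus_reverse:
  "u \<noteq> v \<Longrightarrow> demand T (u, v) i - demand T (v, u) i = demand (\<lambda>u v. T u v + T v u) (u, v) i"
  by (simp add: demand_def)

text \<open>Reversal exchanges inflow and outflow at every node, so the merged net outflow is
  \<open>\<alpha> u v\<close> times that of \<open>uv\<close> minus that of
  \<open>vu\<close>.\<close>

lemma flow_balance_merge_flow:
  assumes bal: "flow_balance G T x"
    and \<alpha>: "\<And>u v. (u, v) \<in> commodities G \<Longrightarrow> \<alpha> u v * (T u v + T v u) = T' u v"
  shows "flow_balance G T' (merge_flow G \<alpha> x)"
  unfolding flow_balance_def
proof (intro ballI)
  fix k i
  assume k: "k \<in> commodities G" and i: "i \<in> nodes G"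
  obtain u v where uv: "k = (u, v)" by (cases k)
  have com: "(u, v) \<in> commodities G" "(v, u) \<in> commodities G" and "u \<noteq> v"
    using k by (auto simp: uv commodities_def)
  let ?out = "\<lambda>k. \<Sum>j | (i, j) \<in> arcs G. x ((i, j), k)"
  let ?in = "\<lambda>k. \<Sum>j | (j, i) \<in> arcs G. x ((j, i), k)"
  have out: "(\<Sum>j | (i, j) \<in> arcs G. merge_flow G \<alpha> x ((i, j), k)) = \<alpha> u v * (?out (u, v) + ?in (v, u))"
  proof -
    have "(\<Sum>j | (i, j) \<in> arcs G. merge_flow G \<alpha> x ((i, j), k))
        = (\<Sum>j | (i, j) \<in> arcs G. \<alpha> u v * (x ((i, j), (u, v)) + x ((j, i), (v, u))))"
      by (rule sum.cong) (auto simp: uv merge_flow_apply com)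
    then show ?thesis
      by (simp add: sum.distrib arcs_commute[of _ i] flip: sum_distrib_left)
  qed
  have "in": "(\<Sum>j | (j, i) \<in> arcs G. merge_flow G \<alpha> x ((j, i), k)) = \<alpha> u v * (?in (u, v) + ?out (v, u))"
  proof -
    have "(\<Sum>j | (j, i) \<in> arcs G. merge_flow G \<alpha> x ((j, i), k))
        = (\<Sum>j | (j, i) \<in> arcs G. \<alpha> u v * (x ((j, i), (u, v)) + x ((i, j), (v, u))))"
      by (rule sum.cong) (auto simp: uv merge_flow_apply com)
    then show ?thesis
      by (simp add: sum.distrib arcs_commute[of _ i] flip: sum_distrib_left)
  qed
  have bal': "?out k' - ?in k' = demand T k' i" if "k' \<in> commodities G" for k'
    using bal i that by (auto simp: flow_balance_def)
  have "\<alpha> u v * (?out (u, v) + ?in (v, u)) - \<alpha> u v * (?in (u, v) + ?out (v, u))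
      = \<alpha> u v * ((?out (u, v) - ?in (u, v)) - (?out (v, u) - ?in (v, u)))"
    by (simp add: algebra_simps)
  also have "\<dots> = \<alpha> u v * demand (\<lambda>u v. T u v + T v u) (u, v) i"
    by (simp only: bal'[OF com(1)] bal'[OF com(2)] demand_minus_reverse[OF \<open>u \<noteq> v\<close>])
  also have "\<dots> = demand T' k i"
    using \<alpha>[OF com(1)] by (auto simp: demand_def uv algebra_simps)
  finally show "(\<Sum>j | (i, j) \<in> arcs G. merge_flow G \<alpha> x ((i, j), k))
      - (\<Sum>j | (j, i) \<in> arcs G. merge_flow G \<alpha> x ((j, i), k)) = demand T' k i"
    by (simp only: out "in")
qed

lemma common_constraints_merge_flow:
  assumes "common_constraints G T x y"
    and "\<And>u v. (u, v) \<in> commodities G \<Longrightarrow> \<alpha> u v * (T u v + T v u) = T' u v"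
    and "\<And>u v. (u, v) \<in> commodities G \<Longrightarrow> \<alpha> u v \<ge> 0"
  shows "common_constraints G T' (merge_flow G \<alpha> x) y"
proof -
  have "merge_flow G \<alpha> x ((i, j), (u, v)) \<ge> 0" if "(i, j) \<in> arcs G" "(u, v) \<in> commodities G" for i j u v
  proof -
    have "x ((i, j), (u, v)) \<ge> 0" "x ((j, i), (v, u)) \<ge> 0"
      using assms(1) that
      by (auto simp: common_constraints_def arcs_commute commodities_commute)
    then show ?thesis
      using that assms(3) by (simp add: merge_flow_apply)
  qed
  then show ?thesis
    using assms(1) flow_balance_merge_flow[OF _ assms(2)]
    by (auto simp: common_constraints_def merge_flow_in_flow_space)
qed

lemma opt_value_le:
  assumes "\<And>z. z \<in> S \<Longrightarrow> \<Phi> z \<in> S' \<and> g (\<Phi> z) = f z"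
  shows "opt_value g S' \<le> opt_value f S"
  unfolding opt_value_def
proof (rule INF_greatest)
  fix z
  assume "z \<in> S"
  then show "(INF w \<in> S'. ereal (g w)) \<le> ereal (f z)"
    using INF_lower[of "\<Phi> z" S' "\<lambda>w. ereal (g w)"] assms by auto
qed

text \<open>The two maps need not be inverse to each other: a point \<open>w\<close> better than
  \<open>\<Phi> z\<close> would give \<open>\<Psi> w\<close> better than \<open>z\<close>.\<close>

lemma opt_solutions_image:
  fixes f g :: "_ \<Rightarrow> real"
  assumes "\<And>z. z \<in> S \<Longrightarrow> \<Phi> z \<in> S' \<and> g (\<Phi> z) = f z"
    and "\<And>w. w \<in> S' \<Longrightarrow> \<Psi> w \<in> S \<and> f (\<Psi> w) = g w"
  shows "\<Phi> ` opt_solutions f S \<subseteq> opt_solutions g S'"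
proof (rule image_subsetI)
  fix z
  assume "z \<in> opt_solutions f S"
  then have z: "z \<in> S" and min: "\<And>z'. z' \<in> S \<Longrightarrow> \<not> f z' < f z"
    unfolding opt_solutions_def is_arg_min_def by blast+
  have "\<not> g w < g (\<Phi> z)" if "w \<in> S'" for w
    using min[of "\<Psi> w"] assms(1)[OF z] assms(2)[OF that] by simp
  then show "\<Phi> z \<in> opt_solutions g S'"
    using assms(1)[OF z] unfolding opt_solutions_def is_arg_min_def by blast
qed

text \<open>The factor \<open>1/4\<close> in the first case makes the weights of \<open>uv\<close> and \<open>vu\<close> add up to \<open>1/2\<close>.\<close>

definition share :: "'v traffic \<Rightarrow> 'v \<Rightarrow> 'v \<Rightarrow> real" where
  "share T u v = (if T u v + T v u = 0 then 1 / 4 else T u v / (2 * (T u v + T v u)))"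

lemma share_add_share: "share T u v + share T v u = 1 / 2"
proof (cases "T u v + T v u = 0")
  case False
  have "share T u v + share T v u = (T u v + T v u) / (2 * (T u v + T v u))"
    using False by (simp add: share_def add.commute add_divide_distrib)
  then show ?thesis
    using False by simp
qed (simp add: share_def add.commute)

lemma
  assumes "traffic_matrix G T" "(u, v) \<in> commodities G"
  shows share_nonneg: "share T u v \<ge> 0"
    and share_mult: "share T u v * (2 * (T u v + T v u)) = T u v"
proof -
  \<comment> \<open>By nonnegativity a vanishing sum forces \<open>T u v = 0\<close>, so the product
    is right for the default weight too.\<close>
  have "T u v \<ge> 0" "T v u \<ge> 0"
    using assms by (auto simp: traffic_matrix_def commodities_def)
  then show "share T u v \<ge> 0" "share T u v * (2 * (T u v + T v u)) = T u v"
    by (auto simp: share_def)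
qed

theorem proposition2:
  fixes G :: "'v network"
    and T :: "'v traffic"
    and f g :: "'v flow \<times> 'v capacity \<Rightarrow> real"
  assumes "network G"
    and "traffic_matrix G T"
    and "arc_symmetric G f"
  defines "U \<equiv> undirected_model G T"
    and "B \<equiv> bidirected_model G (\<lambda>i j. 2 * symmetric_counterpart T i j)"
    and "g \<equiv> (\<lambda>(x, y). f (scale_flow G (1 / 2) x, y))"
  shows "opt_value f U = opt_value g B \<and>
    (\<exists>\<Phi> \<Psi>.
      (\<forall>z \<in> U. \<Phi> z \<in> B \<and> g (\<Phi> z) = f z) \<and>
      (\<forall>z \<in> B. \<Psi> z \<in> U \<and> f (\<Psi> z) = g z) \<and>
      \<Phi> ` opt_solutions f U \<subseteq> opt_solutions g B \<and>
      \<Psi> ` opt_solutions g B \<subseteq> opt_solutions f U) \<and>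
    (opt_solutions f U \<noteq> {} \<longleftrightarrow> opt_solutions g B \<noteq> {})"
proof -
  define \<Phi> where "\<Phi> = (\<lambda>(x, y :: 'v capacity). (merge_flow G (\<lambda>u v. 1) x, y))"
  define \<Psi> where "\<Psi> = (\<lambda>(x, y :: 'v capacity). (merge_flow G (share T) x, y))"
  have \<Phi>: "\<Phi> z \<in> B \<and> g (\<Phi> z) = f z" if "z \<in> U" for z
  proof -
    obtain x y where z: "z = (x, y)" by (cases z)
    have cc: "common_constraints G T x y"
      and cap: "\<And>i j. {i, j} \<in> edges G \<Longrightarrow>
        arc_load G x (i, j) + arc_load G x (j, i) \<le> edge_capacity G y {i, j}"
      using that by (auto simp: z U_def undirected_model_def)
    let ?x = "merge_flow G (\<lambda>u v. 1) x"
    have "common_constraints G (\<lambda>i j. 2 * symmetric_counterpart T i j) ?x y"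
      by (rule common_constraints_merge_flow[OF cc]) (auto simp: symmetric_counterpart_def)
    moreover have "max (arc_load G ?x (i, j)) (arc_load G ?x (j, i)) \<le> edge_capacity G y {i, j}"
      if "{i, j} \<in> edges G" for i j
    proof -
      have "(i, j) \<in> arcs G" "(j, i) \<in> arcs G"
        using that by (auto simp: arcs_def insert_commute)
      then show ?thesis
        using cap[OF that] by (simp add: arc_load_merge_flow)
    qed
    \<comment> \<open>Weights 1 and 1 double every four-term sum, and the scaling by 1/2 undoes
      this.\<close>
    moreover have "f (scale_flow G (1 / 2) ?x, y) = f (x, y)"
      using cc
      by (intro arc_symmetricD[OF assms(3)])
        (auto simp: scale_flow_in_flow_space common_constraints_def
          pair_flow_scale_flow pair_flow_merge_flow)
    ultimately show ?thesis
      by (simp add: z \<Phi>_def B_def g_def bidirected_model_def)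
  qed
  have \<Psi>: "\<Psi> z \<in> U \<and> f (\<Psi> z) = g z" if "z \<in> B" for z
  proof -
    obtain x y where z: "z = (x, y)" by (cases z)
    have cc: "common_constraints G (\<lambda>i j. 2 * symmetric_counterpart T i j) x y"
      and cap: "\<And>i j. {i, j} \<in> edges G \<Longrightarrow>
        max (arc_load G x (i, j)) (arc_load G x (j, i)) \<le> edge_capacity G y {i, j}"
      using that by (auto simp: z B_def bidirected_model_def)
    let ?x = "merge_flow G (share T) x"
    have "common_constraints G T ?x y"
    proof (rule common_constraints_merge_flow[OF cc])
      fix u v
      assume uv: "(u, v) \<in> commodities G"
      \<comment> \<open>The matrix of \<open>x\<close> is already symmetric, so adding its transpose
        doubles it; this is the 2 in the denominator of \<open>share\<close>.\<close>
      show "share T u v * (2 * symmetric_counterpart T u v + 2 * symmetric_counterpart T v u) = T u v"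
        using share_mult[OF assms(2) uv] by (simp add: symmetric_counterpart_def algebra_simps)
      show "share T u v \<ge> 0"
        by (rule share_nonneg[OF assms(2) uv])
    qed
    moreover have "arc_load G ?x (i, j) + arc_load G ?x (j, i) \<le> edge_capacity G y {i, j}"
      if "{i, j} \<in> edges G" for i j
      using edge_load_merge_flow[of i j G "share T" "1 / 2" x] cap[OF that] that
      by (simp add: arcs_def share_add_share)
    \<comment> \<open>Both flows halve the four-term sums of \<open>x\<close>, the left one because
      the two shares add up to 1/2.\<close>
    moreover have "f (?x, y) = f (scale_flow G (1 / 2) x, y)"
      using cc
      by (intro arc_symmetricD[OF assms(3)])
        (auto simp: scale_flow_in_flow_space merge_flow_in_flow_space common_constraints_def
          pair_flow_scale_flow pair_flow_merge_flow share_add_share)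
    ultimately show ?thesis
      by (simp add: z \<Psi>_def U_def g_def undirected_model_def)
  qed
  have "opt_value f U = opt_value g B"
    using opt_value_le[of U \<Phi> B g f, OF \<Phi>] opt_value_le[of B \<Psi> U f g, OF \<Psi>] by (rule antisym[rotated])
  moreover have "\<Phi> ` opt_solutions f U \<subseteq> opt_solutions g B"
    by (rule opt_solutions_image[of U \<Phi> B g f \<Psi>, OF \<Phi> \<Psi>])
  moreover have "\<Psi> ` opt_solutions g B \<subseteq> opt_solutions f U"
    by (rule opt_solutions_image[of B \<Psi> U f g \<Phi>, OF \<Psi> \<Phi>])
  \<comment> \<open>The two image inclusions also give the equivalence of nonemptiness.\<close>
  ultimately show ?thesis
    using \<Phi> \<Psi> by blast
qed

end
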